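(* Let $d>k\ge1$ be integers, $A\in\mathbb{R}^{d\times d}$, and let $Y_0\in\mathbb{R}^{(d-k)\times k}$ be arbitrary. Let $Y(t;Y_0)$ be the solution and $t_A(Y_0)$ the escape time of the Riccati differential equation associated with $A$ with initial state $Y_0$ (see context). Assume that $t_A(Y_0)<\infty$. Define the function $\Delta\colon[0,t_A(Y_0))\to(0,\infty)$ by $$\Delta(t)=\frac{1}{\|A\|}\,W\!\left(\frac{\|A\|}{\left\|\begin{bmatrix} I_k & 0 \end{bmatrix}A\right\|\,\left\|\begin{bmatrix} I_k \\ Y(t;Y_0) \end{bmatrix}\right\|}\right).$$ Then the real sequence $\{t_n\}_{n=0}^\infty$ defined by $t_0=0$ and $t_{n+1}=t_n+\Delta(t_n)$ for $n=0,1,\dots$ (which is well defined, i.e. each $t_n$ lies in $[0,t_A(Y_0))$) satisfies $$\lim_{n\to\infty}t_n=t_A(Y_0).$$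
   Context: Partition $A=\begin{bmatrix} A_{11} & A_{12} \\ A_{21} & A_{22} \end{bmatrix}$ with $A_{11}\in\mathbb{R}^{k\times k}$, $A_{12}\in\mathbb{R}^{k\times(d-k)}$, $A_{21}\in\mathbb{R}^{(d-k)\times k}$, $A_{22}\in\mathbb{R}^{(d-k)\times(d-k)}$. The Riccati differential equation associated with $A$ is $$\frac{dY}{dt}=A_{21}+A_{22}Y-YA_{11}-YA_{12}Y,\qquad Y\in\mathbb{R}^{(d-k)\times k}.$$ $Y(\cdot;Y_0)$ denotes its solution with $Y(0)=Y_0$. The escape time $t_A(Y_0)\in(0,\infty]$ is the first time $t>0$ at which the solution $Y(t;Y_0)$ does not exist ($+\infty$ if the solution exists for all $t\ge0$). $\|M\|$ denotes the maximum singular value of a matrix $M$, $I_k$ the $k\times k$ identity matrix, and $\begin{bmatrix} I_k & 0 \end{bmatrix}\in\mathbb{R}^{k\times d}$. $W(\cdot)$ is the principal branch of the Lambert $W$-function on $[0,\infty)$, i.e. the inverse of the mapping $[0,\infty)\to[0,\infty)$, $x\mapsto xe^x$. *)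

theory Defs
  imports "HOL-Analysis.Analysis"
begin

text \<open>
  With \<open>CARD('k) = k\<close> and \<open>CARD('m) = d - k\<close>, a real \<open>d \<times> d\<close> matrix partitioned into blocks
  is an element of \<open>real^('k + 'm)^('k + 'm)\<close>: the indices \<open>Inl i\<close> are the first \<open>k\<close> ones and
  the indices \<open>Inr i\<close> the remaining \<open>d - k\<close> ones. The constraints \<open>k \<ge> 1\<close> and \<open>d > k\<close> hold because
  types are nonempty. A matrix with \<open>r\<close> rows and \<open>c\<close> columns has type \<open>real^'c^'r\<close>.
\<close>

definition block11 :: "real^('k::finite + 'm::finite)^('k + 'm) \<Rightarrow> real^'k^'k" where
  "block11 A = (\<chi> i j. A $ Inl i $ Inl j)"

definition block12 :: "real^('k::finite + 'm::finite)^('k + 'm) \<Rightarrow> real^'m^'k" where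
  "block12 A = (\<chi> i j. A $ Inl i $ Inr j)"

definition block21 :: "real^('k::finite + 'm::finite)^('k + 'm) \<Rightarrow> real^'k^'m" where
  "block21 A = (\<chi> i j. A $ Inr i $ Inl j)"

definition block22 :: "real^('k::finite + 'm::finite)^('k + 'm) \<Rightarrow> real^'m^'m" where
  "block22 A = (\<chi> i j. A $ Inr i $ Inr j)"

text \<open>The block row \<open>[I 0]\<close> and the block column of \<open>I\<close> above \<open>Y\<close>.\<close>

definition id_zero_row :: "real^('k::finite + 'm::finite)^'k" where
  "id_zero_row = (\<chi> i j. case j of Inl l \<Rightarrow> mat 1 $ i $ l | Inr _ \<Rightarrow> 0)"

definition id_over :: "real^'k^'m \<Rightarrow> real^'k^('k::finite + 'm::finite)" where
  "id_over Y = (\<chi> i j. case i of Inl l \<Rightarrow> mat 1 $ l $ j | Inr l \<Rightarrow> Y $ l $ j)"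

text \<open>
  Square roots of the eigenvalues of \<open>M\<^sup>T M\<close>. If \<open>M\<close> has more columns than rows, this set may contain
  an additional \<open>0\<close>, which does not affect the maximum.
\<close>

definition singular_values :: "real^'c^'r \<Rightarrow> real set" where
  "singular_values M =
     {s. 0 \<le> s \<and> (\<exists>v. v \<noteq> 0 \<and> (transpose M ** M) *v v = s\<^sup>2 *\<^sub>R v)}"

definition max_singular_value :: "real^'c^'r \<Rightarrow> real" where
  "max_singular_value M = Max (singular_values M)"

text \<open>The set is finite and nonempty, so that \<^const>\<open>Max\<close> is meaningful; its value is the operator norm.\<close>

lemma inner_gram: "((transpose M ** M) *v u) \<bullet> v = (M *v u) \<bullet> (M *v (v :: real^'c))"
  for M :: "real^'c^'r"
  by (metis dot_lmul_matrix inner_commute matrix_vector_mul_assoc transpose_matrix_vector transpose_transpose)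

lemma finite_singular_values: "finite (singular_values M)" for M :: "real^'c^'r"
proof -
  let ?B = "transpose M ** M"
  have "\<forall>s\<in>singular_values M. \<exists>v. v \<noteq> 0 \<and> ?B *v v = s\<^sup>2 *\<^sub>R v"
    by (auto simp: singular_values_def)
  then obtain v where v: "\<And>s. s \<in> singular_values M \<Longrightarrow> v s \<noteq> 0 \<and> ?B *v v s = s\<^sup>2 *\<^sub>R v s"
    by metis
  have orth: "v s \<bullet> v r = 0"
    if "s \<in> singular_values M" "r \<in> singular_values M" "s \<noteq> r" for s r
  proof -
    have "s\<^sup>2 * (v s \<bullet> v r) = r\<^sup>2 * (v s \<bullet> v r)"
      using inner_gram[of M "v s" "v r"] inner_gram[of M "v r" "v s"] v[OF that(1)] v[OF that(2)]
      by (simp add: inner_commute)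
    moreover have "s\<^sup>2 \<noteq> r\<^sup>2"
      using that by (auto simp: singular_values_def power2_eq_iff)
    ultimately show ?thesis by simp
  qed
  have inj: "inj_on v (singular_values M)"
    by (rule inj_onI) (metis orth v inner_eq_zero_iff)
  have "pairwise orthogonal (v ` singular_values M)"
    using orth by (auto simp: pairwise_def orthogonal_def)
  moreover have "0 \<notin> v ` singular_values M" using v by force
  ultimately have "independent (v ` singular_values M)"
    by (rule pairwise_orthogonal_independent)
  then have "finite (v ` singular_values M)" by (rule independent_imp_finite)
  then show ?thesis using inj by (rule finite_imageD)
qed

lemma onorm_in_singular_values: "onorm ((*v) M) \<in> singular_values M" for M :: "real^'c^'r"
proof -
  let ?s = "onorm ((*v) M)"
  have bl: "bounded_linear ((*v) M)" by (rule matrix_vector_mul_bounded_linear)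
  have "\<exists>v\<in>sphere 0 1. \<forall>u\<in>sphere 0 1. norm (M *v u) \<le> norm (M *v v)"
    by (intro continuous_attains_sup) (auto intro!: continuous_intros)
  then obtain v where v1: "norm v = 1"
    and vmax: "\<And>u. norm u = 1 \<Longrightarrow> norm (M *v u) \<le> norm (M *v v)" by auto
  have s: "norm (M *v v) = ?s"
  proof (rule antisym)
    show "norm (M *v v) \<le> ?s" using onorm[OF bl, of v] v1 by simp
    show "?s \<le> norm (M *v v)"
    proof (rule onorm_bound)
      fix u :: "real^'c"
      show "norm (M *v u) \<le> norm (M *v v) * norm u"
      proof (cases "u = 0")
        case False
        have "norm (M *v (u /\<^sub>R norm u)) \<le> norm (M *v v)"
          using False by (intro vmax) simp
        then show ?thesis using False
          by (simp add: matrix_vector_mult_scaleR field_simps)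
      qed simp
    qed simp
  qed
  define w where "w = (transpose M ** M) *v v"
  have s0: "0 \<le> ?s" by (simp add: onorm_pos_le[OF bl])
  have wv: "w \<bullet> v = ?s\<^sup>2"
    unfolding w_def inner_gram by (simp add: s flip: power2_norm_eq_inner)
  have "(norm w)\<^sup>2 = (M *v v) \<bullet> (M *v w)"
    by (simp add: w_def flip: inner_gram power2_norm_eq_inner)
  also have "\<dots> \<le> norm (M *v v) * norm (M *v w)" by (rule norm_cauchy_schwarz)
  also have "\<dots> \<le> ?s * (?s * norm w)"
    unfolding s using onorm[OF bl, of w] s0 by (intro mult_left_mono)
  finally have "norm w * norm w \<le> ?s\<^sup>2 * norm w" by (simp add: power2_eq_square mult_ac)
  then have "norm w \<le> ?s\<^sup>2" by (cases "w = 0") auto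
  then have "(norm w)\<^sup>2 \<le> (?s\<^sup>2)\<^sup>2" by (intro power_mono) auto
  moreover have "(norm (w - ?s\<^sup>2 *\<^sub>R v))\<^sup>2 = (norm w)\<^sup>2 - (?s\<^sup>2)\<^sup>2"
  proof -
    have "v \<bullet> v = 1" using v1 by (simp flip: power2_norm_eq_inner)
    then show ?thesis using wv
      by (simp add: power2_norm_eq_inner inner_diff inner_commute[of v w] power2_eq_square[of "?s\<^sup>2"])
  qed
  ultimately have "(norm (w - ?s\<^sup>2 *\<^sub>R v))\<^sup>2 \<le> 0" by simp
  then have "w = ?s\<^sup>2 *\<^sub>R v" by simp
  moreover have "v \<noteq> 0" using v1 by auto
  ultimately show ?thesis
    unfolding singular_values_def w_def using s0 by auto
qed

lemma max_singular_value_eq_onorm: "max_singular_value M = onorm ((*v) M)" for M :: "real^'c^'r"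
  unfolding max_singular_value_def
proof (rule Max_eqI[OF finite_singular_values _ onorm_in_singular_values])
  fix s assume "s \<in> singular_values M"
  then obtain v where s0: "0 \<le> s" and v: "v \<noteq> 0" "(transpose M ** M) *v v = s\<^sup>2 *\<^sub>R v"
    by (auto simp: singular_values_def)
  have "(norm (M *v v))\<^sup>2 = (s * norm v)\<^sup>2"
    using inner_gram[of M v v] v(2) by (simp add: power2_norm_eq_inner power_mult_distrib)
  then have "norm (M *v v) = s * norm v" using s0 by simp
  moreover have "norm (M *v v) \<le> onorm ((*v) M) * norm v"
    by (rule onorm[OF matrix_vector_mul_bounded_linear])
  ultimately show "s \<le> onorm ((*v) M)" using v(1) by simp
qed

definition lambert_W :: "real \<Rightarrow> real" where
  "lambert_W = the_inv_into {0..} (\<lambda>x. x * exp x)"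

definition riccati_rhs :: "real^('k::finite + 'm::finite)^('k + 'm) \<Rightarrow> real^'k^'m \<Rightarrow> real^'k^'m" where
  "riccati_rhs A Y = block21 A + block22 A ** Y - Y ** block11 A - Y ** block12 A ** Y"

definition riccati_solution_on ::
  "real^('k::finite + 'm::finite)^('k + 'm) \<Rightarrow> real^'k^'m \<Rightarrow> real set \<Rightarrow> (real \<Rightarrow> real^'k^'m) \<Rightarrow> bool" where
  "riccati_solution_on A Y0 T Y \<longleftrightarrow>
     Y 0 = Y0 \<and> (\<forall>t\<in>T. (Y has_vector_derivative riccati_rhs A (Y t)) (at t within T))"

text \<open>The solution exists at time \<open>t\<close> if there is a solution on the whole interval \<open>[0, t]\<close>.\<close>

definition riccati_exists_at :: "real^('k::finite + 'm::finite)^('k + 'm) \<Rightarrow> real^'k^'m \<Rightarrow> real \<Rightarrow> bool" where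
  "riccati_exists_at A Y0 t \<longleftrightarrow> (\<exists>Y. riccati_solution_on A Y0 {0..t} Y)"

text \<open>The infimum of the empty set is \<open>\<infinity>\<close>.\<close>

definition escape_time :: "real^('k::finite + 'm::finite)^('k + 'm) \<Rightarrow> real^'k^'m \<Rightarrow> ereal" where
  "escape_time A Y0 = Inf {ereal t |t. 0 < t \<and> \<not> riccati_exists_at A Y0 t}"

text \<open>
  \<open>Y(t; Y\<^sub>0)\<close>, meaningful for \<open>0 \<le> t\<close> below the escape time. The value is unique because the
  right-hand side of the equation is polynomial, hence locally Lipschitz.
\<close>

definition riccati_flow :: "real^('k::finite + 'm::finite)^('k + 'm) \<Rightarrow> real^'k^'m \<Rightarrow> real \<Rightarrow> real^'k^'m" where
  "riccati_flow A Y0 t = (THE y. \<exists>Y. riccati_solution_on A Y0 {0..t} Y \<and> Y t = y)"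

definition riccati_step :: "real^('k::finite + 'm::finite)^('k + 'm) \<Rightarrow> real^'k^'m \<Rightarrow> real \<Rightarrow> real" where
  "riccati_step A Y0 t =
     1 / max_singular_value A *
     lambert_W (max_singular_value A /
       (max_singular_value (id_zero_row ** A) * max_singular_value (id_over (riccati_flow A Y0 t))))"

end

theory Submission
  imports Defs
begin

text \<open>
  Write \<open>a = \<parallel>A\<parallel>\<close>, \<open>b = \<parallel>[I 0] A\<parallel>\<close> and \<open>N(s)\<close> for the norm of \<open>I\<close> above \<open>Y(s)\<close>. If \<open>X' = A X\<close> starts at
  \<open>I\<close> above \<open>Y(s)\<close>, with upper block \<open>U\<close> and lower block \<open>V\<close>, then \<open>V U\<^sup>-\<^sup>1\<close> continues the Riccati solution
  from time \<open>s\<close> as long as \<open>U\<close> is invertible. Gronwall's inequality gives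
  \<open>\<parallel>U(h) - I\<parallel> \<le> b N(s) (exp (a h) - 1) / a\<close>, so the solution exists at least until this bound reaches \<open>1\<close>.
  The step \<open>h = \<Delta>(s)\<close> is characterized by \<open>b N(s) h exp (a h) = 1\<close>, and \<open>exp (a h) - 1 < a h exp (a h)\<close>;
  hence every step stays strictly below the escape time. The increasing sequence \<open>t\<^sub>n\<close> therefore
  converges. If its limit were below the escape time, \<open>N\<close> would be bounded along the sequence, while
  the step lengths tend to \<open>0\<close>, contradicting \<open>b N(t\<^sub>n) h\<^sub>n exp (a h\<^sub>n) = 1\<close>.
\<close>

section \<open>Calculus of matrix-valued functions\<close>

lemma bounded_bilinear_matrix_matrix_mult:
  "bounded_bilinear ((**) :: real^'b^'a \<Rightarrow> real^'c^'b \<Rightarrow> real^'c^'a)"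
  by (auto simp: bilinear_conv_bounded_bilinear[symmetric] bilinear_def linear_iff vec_eq_iff
      matrix_matrix_mult_def algebra_simps sum.distrib sum_distrib_left)

lemma bounded_bilinear_matrix_vector_mult:
  "bounded_bilinear ((*v) :: real^'b^'a \<Rightarrow> real^'b \<Rightarrow> real^'a)"
  by (auto simp: bilinear_conv_bounded_bilinear[symmetric] bilinear_def linear_iff vec_eq_iff
      matrix_vector_mult_def algebra_simps sum.distrib sum_distrib_left)

lemmas matrix_mult_diff_left = bounded_bilinear.diff_left[OF bounded_bilinear_matrix_matrix_mult]
lemmas matrix_mult_diff_right = bounded_bilinear.diff_right[OF bounded_bilinear_matrix_matrix_mult]
lemmas matrix_mult_add_left = bounded_bilinear.add_left[OF bounded_bilinear_matrix_matrix_mult]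
lemmas matrix_mult_add_right = bounded_bilinear.add_right[OF bounded_bilinear_matrix_matrix_mult]
lemmas has_vector_derivative_matrix_mult =
  bounded_bilinear.has_vector_derivative[OF bounded_bilinear_matrix_matrix_mult]

text \<open>With difference quotients, the inverse rule becomes an algebraic identity followed by a
  passage to the limit.\<close>

lemma has_vector_derivative_iff_quotient_tendsto:
  "(f has_vector_derivative D) (at x within S) \<longleftrightarrow>
   ((\<lambda>y. (f y - f x) /\<^sub>R (y - x)) \<longlongrightarrow> D) (at x within S)"
proof -
  have "(f has_vector_derivative D) (at x within S) \<longleftrightarrow>
      ((\<lambda>y. norm (f y - f x - (y - x) *\<^sub>R D) / norm (y - x)) \<longlongrightarrow> 0) (at x within S)"
    by (simp add: has_vector_derivative_def has_derivative_iff_norm bounded_linear_scaleR_left)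
  also have "\<dots> \<longleftrightarrow> ((\<lambda>y. norm ((f y - f x) /\<^sub>R (y - x) - D)) \<longlongrightarrow> 0) (at x within S)"
  proof (rule filterlim_cong[OF refl refl])
    have "norm (f y - f x - (y - x) *\<^sub>R D) / norm (y - x) = norm ((f y - f x) /\<^sub>R (y - x) - D)"
      if "y \<noteq> x" for y
    proof -
      have "(f y - f x) /\<^sub>R (y - x) - D = (f y - f x - (y - x) *\<^sub>R D) /\<^sub>R (y - x)"
        using that by (simp add: scaleR_diff_right)
      then show ?thesis by (simp add: divide_inverse mult.commute)
    qed
    then show "\<forall>\<^sub>F y in at x within S. norm (f y - f x - (y - x) *\<^sub>R D) / norm (y - x)
        = norm ((f y - f x) /\<^sub>R (y - x) - D)"
      by (auto simp: eventually_at_filter)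
  qed
  also have "\<dots> \<longleftrightarrow> ((\<lambda>y. (f y - f x) /\<^sub>R (y - x)) \<longlongrightarrow> D) (at x within S)"
    unfolding tendsto_norm_zero_iff by (rule LIM_zero_iff)
  finally show ?thesis .
qed

text \<open>The identity \<open>W s ** (U s - U t) ** W t = W t - W s\<close> expresses the
  difference quotient of \<open>W\<close> through that of \<open>U\<close>. Continuity of
  \<open>W\<close> at \<open>t\<close> is then all that the limit requires;
  \<open>tendsto_matrix_inverse\<close> supplies it.\<close>

lemma has_vector_derivative_matrix_inverse:
  fixes U W :: "real \<Rightarrow> real^'n^'n"
  assumes U: "(U has_vector_derivative U') (at t within S)"
    and W: "(W \<longlongrightarrow> W t) (at t within S)"
    and inv: "\<And>s. s \<in> S \<Longrightarrow> W s ** U s = mat 1" "\<And>s. s \<in> S \<Longrightarrow> U s ** W s = mat 1"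
    and t: "t \<in> S"
  shows "(W has_vector_derivative - (W t ** U' ** W t)) (at t within S)"
proof -
  interpret bounded_bilinear "(**) :: real^'n^'n \<Rightarrow> real^'n^'n \<Rightarrow> real^'n^'n"
    by (rule bounded_bilinear_matrix_matrix_mult)
  have "((\<lambda>s. - (W s ** ((U s - U t) /\<^sub>R (s - t)) ** W t)) \<longlongrightarrow> - (W t ** U' ** W t)) (at t within S)"
    using U unfolding has_vector_derivative_iff_quotient_tendsto
    by (intro tendsto_minus tendsto W tendsto_const)
  moreover have "- (W s ** ((U s - U t) /\<^sub>R (s - t)) ** W t) = (W s - W t) /\<^sub>R (s - t)"
    if "s \<in> S" for s
  proof -
    have "W s ** (U s - U t) ** W t = W t - W s"
      using that t by (simp add: diff_left diff_right inv matrix_mul_assoc[symmetric])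
    then show ?thesis
      by (simp add: scaleR_left scaleR_right flip: scaleR_minus_right)
  qed
  then have "\<forall>\<^sub>F s in at t within S. - (W s ** ((U s - U t) /\<^sub>R (s - t)) ** W t) = (W s - W t) /\<^sub>R (s - t)"
    by (auto simp: eventually_at_filter)
  ultimately show ?thesis
    unfolding has_vector_derivative_iff_quotient_tendsto by (rule Lim_transform_eventually)
qed

section \<open>Gronwall's inequality and linear equations\<close>

text \<open>By the assumption on \<open>z' s \<bullet> z s\<close>, the function
  \<open>exp (- 2 * L * s) * (z s \<bullet> z s)\<close> has nonpositive derivative. The lemma
  serves both the growth of linear solutions and the uniqueness of Riccati solutions.\<close>

lemma gronwall_inner:
  fixes z :: "real \<Rightarrow> 'a::real_inner"
  assumes z: "\<And>s. s \<in> {0..T} \<Longrightarrow> (z has_vector_derivative z' s) (at s within {0..T})"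
    and le: "\<And>s. s \<in> {0..T} \<Longrightarrow> z' s \<bullet> z s \<le> L * (z s \<bullet> z s)"
    and t: "t \<in> {0..T}"
  shows "norm (z t) \<le> exp (L * t) * norm (z 0)"
proof (cases "t = 0")
  case False
  let ?f = "\<lambda>s. exp (- 2 * L * s) * (z s \<bullet> z s)"
  have d: "(?f has_real_derivative exp (- 2 * L * s) * (2 * (z' s \<bullet> z s - L * (z s \<bullet> z s))))
      (at s within {0..t})" if "s \<in> {0..t}" for s
  proof -
    have "(z has_vector_derivative z' s) (at s within {0..t})"
      using z[of s] that t by (auto intro: has_vector_derivative_within_subset)
    note [derivative_intros] =
      bounded_bilinear.has_vector_derivative[OF bounded_bilinear_inner this this,
        folded has_real_derivative_iff_has_vector_derivative]
    show ?thesis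
      by (auto intro!: derivative_eq_intros simp: algebra_simps inner_commute)
  qed
  have "\<exists>s\<in>{0<..<t}. ?f t - ?f 0 =
      exp (- 2 * L * s) * (2 * (z' s \<bullet> z s - L * (z s \<bullet> z s))) * (t - 0)"
    using False t d by (intro mvt_simple) (auto simp: has_field_derivative_def)
  then obtain s where s: "s \<in> {0<..<t}"
    and eq: "?f t - ?f 0 = exp (- 2 * L * s) * (2 * (z' s \<bullet> z s - L * (z s \<bullet> z s))) * (t - 0)" ..
  have "z' s \<bullet> z s - L * (z s \<bullet> z s) \<le> 0" using le[of s] s t by simp
  then have "?f t - ?f 0 \<le> 0"
    using t unfolding eq by (intro mult_nonpos_nonneg mult_nonneg_nonpos) auto
  then have "exp (- 2 * L * t) * (z t \<bullet> z t) \<le> z 0 \<bullet> z 0" by simp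
  then have "exp (2 * L * t) * (exp (- 2 * L * t) * (z t \<bullet> z t)) \<le> exp (2 * L * t) * (z 0 \<bullet> z 0)"
    by (rule mult_left_mono) simp
  then have "(norm (z t))\<^sup>2 \<le> (exp (L * t) * norm (z 0))\<^sup>2"
    by (simp add: power2_norm_eq_inner power_mult_distrib mult.assoc[symmetric]
        flip: exp_add exp_double)
  then show ?thesis by (rule power2_le_imp_le) simp
qed simp

text \<open>The solution is the exponential series of \<open>t A\<close> applied to
  \<open>B\<close>. It is summed entry by entry, so that termwise differentiation of real power
  series applies.\<close>

lemma matrix_linear_ode_solution:
  fixes A :: "real^'n^'n" and B :: "real^'c^'n"
  obtains X where "X 0 = B" "\<And>t. (X has_vector_derivative A ** X t) (at t)"
proof -
  define P where "P n = ((**) A ^^ n) B" for n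
  define C where "C = (\<Sum>i\<in>UNIV. \<Sum>k\<in>UNIV. \<bar>A $ i $ k\<bar>)"
  define M where "M = (\<Sum>i\<in>UNIV. \<Sum>j\<in>UNIV. \<bar>B $ i $ j\<bar>)"
  define c where "c i j n = P n $ i $ j / fact n" for i j n
  define X where "X t = (\<chi> i j. \<Sum>n. c i j n * t ^ n)" for t
  have PSuc: "P (Suc n) $ i $ j = (\<Sum>k\<in>UNIV. A $ i $ k * P n $ k $ j)" for n i j
    by (simp add: P_def matrix_matrix_mult_def)
  have C0: "0 \<le> C" by (simp add: C_def sum_nonneg)
  \<comment> \<open>\<open>C\<close> adds up the absolute values of all entries of \<open>A\<close>,
    so it dominates every row sum and each multiplication by \<open>A\<close> costs at most a factor
    \<open>C\<close>. The entries are thus majorized by an exponential series.\<close>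
  have bound: "\<bar>P n $ i $ j\<bar> \<le> C ^ n * M" for n i j
  proof (induction n arbitrary: i j)
    case 0
    have "\<bar>B $ i $ j\<bar> \<le> (\<Sum>j\<in>UNIV. \<bar>B $ i $ j\<bar>)" by (rule member_le_sum) auto
    also have "\<dots> \<le> M" unfolding M_def by (rule member_le_sum) (auto intro: sum_nonneg)
    finally show ?case by (simp add: P_def)
  next
    case (Suc n)
    have M0: "0 \<le> M" by (simp add: M_def sum_nonneg)
    have "\<bar>P (Suc n) $ i $ j\<bar> \<le> (\<Sum>k\<in>UNIV. \<bar>A $ i $ k\<bar> * (C ^ n * M))"
      unfolding PSuc
      by (rule order_trans[OF sum_abs sum_mono]) (auto simp: abs_mult intro!: mult_left_mono Suc)
    also have "\<dots> = (\<Sum>k\<in>UNIV. \<bar>A $ i $ k\<bar>) * (C ^ n * M)" by (simp add: sum_distrib_right)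
    also have "\<dots> \<le> C * (C ^ n * M)"
      unfolding C_def using C0 M0
      by (intro mult_right_mono member_le_sum) (auto intro: sum_nonneg simp: C_def)
    finally show ?case by (simp add: mult_ac)
  qed
  have summ: "summable (\<lambda>n. c i j n * t ^ n)" for i j t
  proof (rule summable_comparison_test)
    show "summable (\<lambda>n. M * (inverse (fact n) * (C * \<bar>t\<bar>) ^ n))"
      by (intro summable_mult summable_exp)
    have "norm (c i j n * t ^ n) \<le> M * (inverse (fact n) * (C * \<bar>t\<bar>) ^ n)" for n
      using mult_right_mono[OF bound[of n i j], of "\<bar>t\<bar> ^ n / fact n"]
      by (simp add: c_def abs_mult power_abs power_mult_distrib field_simps)
    then show "\<exists>N. \<forall>n\<ge>N. norm (c i j n * t ^ n) \<le> M * (inverse (fact n) * (C * \<bar>t\<bar>) ^ n)" by blast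
  qed
  \<comment> \<open>The factor \<open>n + 1\<close> from differentiation cancels against the
    factorial, leaving one more multiplication by \<open>A\<close>.\<close>
  have diffs: "diffs (c i j) n = (\<Sum>k\<in>UNIV. A $ i $ k * c k j n)" for i j n
    by (simp add: diffs_def c_def PSuc sum_divide_distrib[symmetric] field_simps del: of_nat_Suc)
  have entry: "((\<lambda>t. X t $ i $ j) has_real_derivative (A ** X t) $ i $ j) (at t)" for i j t
  proof -
    have "(\<Sum>n. diffs (c i j) n * t ^ n) = (\<Sum>n. \<Sum>k\<in>UNIV. A $ i $ k * (c k j n * t ^ n))"
      by (simp add: diffs sum_distrib_right mult.assoc)
    also have "\<dots> = (\<Sum>k\<in>UNIV. \<Sum>n. A $ i $ k * (c k j n * t ^ n))"
      by (intro suminf_sum summable_mult summ)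
    also have "\<dots> = (A ** X t) $ i $ j"
      by (simp add: suminf_mult summ X_def matrix_matrix_mult_def)
    finally show ?thesis
      using termdiffs_strong_converges_everywhere[OF summ, of i j t] by (simp add: X_def)
  qed
  have "(X has_vector_derivative A ** X t) (at t)" for t
    unfolding has_vector_derivative_iff_quotient_tendsto
    using entry[of _ _ t]
    by (intro vec_tendstoI)
      (simp add: has_field_derivative_iff divide_inverse mult.commute)
  moreover have "X 0 $ i $ j = B $ i $ j" for i j
    using powser_zero[of "c i j"] by (simp add: X_def c_def P_def)
  then have "X 0 = B" by (simp add: vec_eq_iff)
  ultimately show thesis using that by blast
qed

section \<open>Upper and lower blocks\<close>

text \<open>The counterpart of \<open>id_zero_row\<close>. Taking the upper or lower block becomes a
  left multiplication, through which derivatives pass by linearity.\<close>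

definition zero_id_row :: "real^('k::finite + 'm::finite)^'m" where
  "zero_id_row = (\<chi> i j. case j of Inl _ \<Rightarrow> 0 | Inr l \<Rightarrow> mat 1 $ i $ l)"

lemma sum_UNIV_Plus:
  "(\<Sum>i\<in>UNIV. f i) = (\<Sum>i\<in>UNIV. f (Inl i)) + (\<Sum>i\<in>UNIV. f (Inr i))"
  for f :: "'a::finite + 'b::finite \<Rightarrow> 'c::comm_monoid_add"
  unfolding UNIV_Plus_UNIV[symmetric] by (subst sum.Plus) auto

lemma id_zero_row_mult_nth: "(id_zero_row ** X) $ i $ j = X $ Inl i $ j"
  for X :: "real^'c^('k::finite + 'm::finite)"
  by (simp add: matrix_matrix_mult_def sum_UNIV_Plus id_zero_row_def mat_def if_distrib[of "\<lambda>x. x * _"]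
      cong: if_cong)

lemma zero_id_row_mult_nth: "(zero_id_row ** X) $ i $ j = X $ Inr i $ j"
  for X :: "real^'c^('k::finite + 'm::finite)"
  by (simp add: matrix_matrix_mult_def sum_UNIV_Plus zero_id_row_def mat_def if_distrib[of "\<lambda>x. x * _"]
      cong: if_cong)

lemma id_zero_row_id_over: "id_zero_row ** id_over Y = mat 1"
  by (simp add: vec_eq_iff id_zero_row_mult_nth id_over_def)

lemma zero_id_row_id_over: "zero_id_row ** id_over Y = Y"
  by (simp add: vec_eq_iff zero_id_row_mult_nth id_over_def)

text \<open>For the blocks \<open>U\<close> and \<open>V\<close> of a solution of
  \<open>X' = A X\<close>, this and the next lemma yield \<open>U' = A11 U + A12 V\<close> and
  \<open>V' = A21 U + A22 V\<close>.\<close>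

lemma id_zero_row_block_mult:
  "id_zero_row ** (A ** X) = block11 A ** (id_zero_row ** X) + block12 A ** (zero_id_row ** X)"
  for X :: "real^'c^('k::finite + 'm::finite)"
  by (simp add: vec_eq_iff id_zero_row_mult_nth,
      simp add: matrix_matrix_mult_def[of A] matrix_matrix_mult_def[of "block11 A"] matrix_matrix_mult_def[of "block12 A"]
      id_zero_row_mult_nth zero_id_row_mult_nth sum_UNIV_Plus, simp add: block11_def block12_def)

lemma zero_id_row_block_mult:
  "zero_id_row ** (A ** X) = block21 A ** (id_zero_row ** X) + block22 A ** (zero_id_row ** X)"
  for X :: "real^'c^('k::finite + 'm::finite)"
  by (simp add: vec_eq_iff zero_id_row_mult_nth,
      simp add: matrix_matrix_mult_def[of A] matrix_matrix_mult_def[of "block21 A"] matrix_matrix_mult_def[of "block22 A"]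
      id_zero_row_mult_nth zero_id_row_mult_nth sum_UNIV_Plus, simp add: block21_def block22_def)

section \<open>Existence of Riccati solutions for a short time\<close>

lemma matrix_tendstoI:
  fixes W :: "'a \<Rightarrow> real^'n^'m"
  assumes "\<And>v. ((\<lambda>s. W s *v v) \<longlongrightarrow> L *v v) F"
  shows "(W \<longlongrightarrow> L) F"
proof (intro vec_tendstoI)
  fix i j
  show "((\<lambda>s. W s $ i $ j) \<longlongrightarrow> L $ i $ j) F"
    using tendsto_vec_nth[OF assms[of "axis j 1"], of i]
    by (simp add: matrix_vector_mult_basis column_def)
qed

text \<open>Since \<open>W s ** ((U s - U t) ** W t) = W t - W s\<close>, the uniform bound
  \<open>K\<close> reduces continuity of the inverse to that of \<open>U\<close>, one vector at a
  time.\<close>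

lemma tendsto_matrix_inverse:
  fixes U W :: "real \<Rightarrow> real^'n^'n"
  assumes U: "(U \<longlongrightarrow> U t) (at t within S)"
    and bound: "\<And>s y. s \<in> S \<Longrightarrow> norm (W s *v y) \<le> K * norm y"
    and inv: "\<And>s. s \<in> S \<Longrightarrow> W s ** U s = mat 1" "\<And>s. s \<in> S \<Longrightarrow> U s ** W s = mat 1"
    and t: "t \<in> S"
  shows "(W \<longlongrightarrow> W t) (at t within S)"
proof (rule matrix_tendstoI)
  fix v
  have "((\<lambda>s. (U s - U t) *v (W t *v v)) \<longlongrightarrow> 0 *v (W t *v v)) (at t within S)"
    using U by (intro bounded_bilinear.tendsto[OF bounded_bilinear_matrix_vector_mult] tendsto_const)
      (simp add: LIM_zero)
  then have lim: "((\<lambda>s. K * norm ((U s - U t) *v (W t *v v))) \<longlongrightarrow> 0) (at t within S)"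
    by (auto intro!: tendsto_eq_intros)
  have "norm (W s *v v - W t *v v) \<le> K * norm ((U s - U t) *v (W t *v v))" if "s \<in> S" for s
  proof -
    have "W s ** ((U s - U t) ** W t) = W t - W s"
      using that t by (simp add: matrix_mult_diff_left matrix_mult_diff_right inv
          matrix_mul_assoc[of "W s" "U s"])
    then have "W s *v ((U s - U t) *v (W t *v v)) = W t *v v - W s *v v"
      by (simp add: matrix_vector_mul_assoc matrix_vector_mult_diff_rdistrib)
    then show ?thesis
      using bound[OF that, of "(U s - U t) *v (W t *v v)"] by (simp add: norm_minus_commute)
  qed
  then have "\<forall>\<^sub>F s in at t within S. norm (W s *v v - W t *v v) \<le> K * norm ((U s - U t) *v (W t *v v))"
    by (auto simp: eventually_at_filter)
  then have "((\<lambda>s. W s *v v - W t *v v) \<longlongrightarrow> 0) (at t within S)"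
    by (rule Lim_null_comparison[OF _ lim])
  then show "((\<lambda>s. W s *v v) \<longlongrightarrow> W t *v v) (at t within S)" by (rule LIM_zero_cancel)
qed

text \<open>
  The solution is the quotient of the two blocks of the solution of the linear equation
  \<open>X' = A X\<close> started at \<^term>\<open>id_over Y1\<close>. The condition on \<open>h\<close> keeps the upper block at
  distance less than \<open>1\<close> from the identity.
\<close>

lemma riccati_exists_at_short:
  fixes A :: "real^('k::finite + 'm::finite)^('k + 'm)"
  assumes h: "0 \<le> h" and a: "0 < a" and Aa: "onorm ((*v) A) \<le> a"
    and small: "onorm ((*v) (id_zero_row ** A :: real^('k + 'm)^'k)) * onorm ((*v) (id_over Y1)) * (exp (a * h) - 1) < a"
  shows "riccati_exists_at A Y1 h"
proof -
  obtain X where X0: "X 0 = id_over Y1"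
    and X: "\<And>t. (X has_vector_derivative A ** X t) (at t)"
    by (rule matrix_linear_ode_solution[where A = A and B = "id_over Y1"]) blast
  define b where "b = onorm ((*v) (id_zero_row ** A :: real^('k + 'm)^'k))"
  define N where "N = onorm ((*v) (id_over Y1 :: real^'k^('k + 'm)))"
  \<comment> \<open>The bound on the distance between \<open>U t\<close> and the identity, evaluated
    at the final time \<open>h\<close>; the assumption \<open>small\<close> says that it is less
    than \<open>1\<close>.\<close>
  define q where "q = b * N * (exp (a * h) - 1) / a"
  define U where "U t = id_zero_row ** X t" for t
  define V where "V t = zero_id_row ** X t" for t
  have q: "q < 1" using small a by (simp add: q_def b_def N_def)
  have b0: "0 \<le> b" and N0: "0 \<le> N" by (simp_all add: b_def N_def onorm_pos_le)
  have deriv_const: "((\<lambda>t. M ** X t) has_vector_derivative M ** (A ** X t)) (at t)"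
    for M :: "real^('k + 'm)^'r" and t
    by (rule bounded_linear.has_vector_derivative[OF
          bounded_bilinear.bounded_linear_right[OF bounded_bilinear_matrix_matrix_mult] X])
  have Xv: "((\<lambda>t. X t *v x) has_vector_derivative A *v (X t *v x)) (at t)" for t x
    using bounded_linear.has_vector_derivative[OF
          bounded_bilinear.bounded_linear_left[OF bounded_bilinear_matrix_vector_mult] X]
    by (simp add: matrix_vector_mul_assoc)
  have growth: "norm (X t *v x) \<le> exp (a * t) * (N * norm x)" if t: "0 \<le> t" for t x
  proof -
    have "(A *v z) \<bullet> z \<le> a * (z \<bullet> z)" for z
    proof -
      have "(A *v z) \<bullet> z \<le> norm (A *v z) * norm z" by (rule norm_cauchy_schwarz)
      also have "\<dots> \<le> (onorm ((*v) A) * norm z) * norm z"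
        by (intro mult_right_mono onorm) auto
      also have "\<dots> \<le> (a * norm z) * norm z" by (intro mult_right_mono Aa) auto
      finally show ?thesis by (simp add: power2_norm_eq_inner[symmetric] power2_eq_square)
    qed
    then have "norm (X t *v x) \<le> exp (a * t) * norm (X 0 *v x)"
      using t by (intro gronwall_inner[where T = t and z = "\<lambda>t. X t *v x"
            and z' = "\<lambda>t. A *v (X t *v x)"] has_vector_derivative_at_within[OF Xv]) auto
    also have "\<dots> \<le> exp (a * t) * (N * norm x)"
      unfolding X0 N_def by (intro mult_left_mono onorm) auto
    finally show ?thesis .
  qed
  have U_near: "norm (U t *v x - x) \<le> q * norm x" if t: "t \<in> {0..h}" for t x
  proof (cases "t = 0")
    case True
    then show ?thesis
      using b0 N0 a h by (simp add: U_def X0 id_zero_row_id_over q_def)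
  next
    case False
    \<comment> \<open>An antiderivative in \<open>s\<close> of the bound
      \<open>b * (exp (a * s) * (N * norm x))\<close> on the derivative of \<open>U s *v x\<close>.
      The mean value inequality used here needs a nondegenerate interval, hence the separate case
      \<open>t = 0\<close>.\<close>
    let ?\<phi> = "\<lambda>s. b * N * norm x * (exp (a * s) / a)"
    have dU: "((\<lambda>s. U s *v x) has_vector_derivative (id_zero_row ** A) *v (X s *v x)) (at s)" for s
      using bounded_linear.has_vector_derivative[OF matrix_vector_mul_bounded_linear[of id_zero_row] Xv[of x s]]
      by (simp add: U_def matrix_vector_mul_assoc matrix_mul_assoc)
    have d\<phi>: "(?\<phi> has_vector_derivative b * (exp (a * s) * (N * norm x))) (at s)" for s
      unfolding has_real_derivative_iff_has_vector_derivative[symmetric]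
      using a by (auto intro!: derivative_eq_intros)
    have "norm (U t *v x - U 0 *v x) \<le> ?\<phi> t - ?\<phi> 0"
    proof (rule differentiable_bound_general)
      show "continuous_on {0..t} (\<lambda>s. U s *v x)"
        by (rule continuous_on_vector_derivative[OF has_vector_derivative_at_within[OF dU]])
      show "continuous_on {0..t} ?\<phi>"
        by (rule continuous_on_vector_derivative[OF has_vector_derivative_at_within[OF d\<phi>]])
      show "norm ((id_zero_row ** A) *v (X s *v x)) \<le> b * (exp (a * s) * (N * norm x))"
        if "0 < s" for s
      proof -
        have "norm ((id_zero_row ** A) *v (X s *v x)) \<le> b * norm (X s *v x)"
          unfolding b_def by (rule onorm[OF matrix_vector_mul_bounded_linear])
        also have "\<dots> \<le> b * (exp (a * s) * (N * norm x))"
          using growth[of s x] that b0 by (intro mult_left_mono) auto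
        finally show ?thesis .
      qed
    qed (use False t dU d\<phi> in auto)
    also have "\<dots> = b * N * (exp (a * t) - 1) / a * norm x"
      using a by (simp add: field_simps)
    also have "\<dots> \<le> q * norm x"
      unfolding q_def using t a b0 N0
      by (intro mult_right_mono divide_right_mono mult_left_mono) auto
    finally show ?thesis by (simp add: U_def X0 id_zero_row_id_over)
  qed
  \<comment> \<open>This bound is used twice: it makes \<open>U t\<close> injective, hence
    invertible, and it bounds the inverses uniformly in \<open>t\<close>.\<close>
  have U_lower: "(1 - q) * norm x \<le> norm (U t *v x)" if "t \<in> {0..h}" for t x
    using U_near[OF that, of x] norm_triangle_ineq2[of x "U t *v x"]
    by (simp add: norm_minus_commute algebra_simps)
  have "invertible (U t)" if "t \<in> {0..h}" for t
  proof -
    have "x = 0" if "U t *v x = 0" for x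
    proof -
      have "(1 - q) * norm x \<le> 0"
        using U_lower[OF \<open>t \<in> {0..h}\<close>, of x] that by simp
      then show ?thesis using q by (simp add: mult_le_0_iff)
    qed
    then show ?thesis
      by (simp add: invertible_left_inverse matrix_left_invertible_ker)
  qed
  then have "\<exists>W. \<forall>t\<in>{0..h}. W t ** U t = mat 1 \<and> U t ** W t = mat 1"
    unfolding invertible_def by (intro bchoice) blast
  then obtain W where W: "\<And>t. t \<in> {0..h} \<Longrightarrow> W t ** U t = mat 1"
      "\<And>t. t \<in> {0..h} \<Longrightarrow> U t ** W t = mat 1" by blast
  have W_bound: "norm (W t *v y) \<le> 1 / (1 - q) * norm y" if "t \<in> {0..h}" for t y
    using U_lower[OF that, of "W t *v y"] q
    by (simp add: matrix_vector_mul_assoc W(2)[OF that] field_simps)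
  have dU: "(U has_vector_derivative id_zero_row ** (A ** X t)) (at t within {0..h})" for t
    unfolding U_def by (rule has_vector_derivative_at_within[OF deriv_const])
  have dV: "(V has_vector_derivative zero_id_row ** (A ** X t)) (at t within {0..h})" for t
    unfolding V_def by (rule has_vector_derivative_at_within[OF deriv_const])
  have "((\<lambda>t. V t ** W t) has_vector_derivative riccati_rhs A (V t ** W t)) (at t within {0..h})"
    if t: "t \<in> {0..h}" for t
  proof -
    have "(U \<longlongrightarrow> U t) (at t within {0..h})"
      using has_vector_derivative_continuous[OF dU] by (simp add: continuous_within)
    then have "(W \<longlongrightarrow> W t) (at t within {0..h})"
      by (rule tendsto_matrix_inverse[OF _ W_bound W t])
    then have "(W has_vector_derivative - (W t ** (id_zero_row ** (A ** X t)) ** W t)) (at t within {0..h})"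
      by (rule has_vector_derivative_matrix_inverse[OF dU _ W t])
    note * = has_vector_derivative_matrix_mult[OF dV this]
    \<comment> \<open>With \<open>Y = V W\<close>, the product rule gives
      \<open>V' W - V W U' W\<close>. Inserting the block equations and cancelling
      \<open>U W\<close> leaves \<open>A21 + A22 Y - Y A11 - Y A12 Y\<close>.\<close>
    have UW: "M ** U t ** W t = M" for M :: "real^'k^'r"
      using W(2)[OF t] by (simp add: matrix_mul_assoc[symmetric])
    show ?thesis
      by (rule has_vector_derivative_eq_rhs[OF *])
        (unfold id_zero_row_block_mult zero_id_row_block_mult U_def[symmetric] V_def[symmetric],
          simp add: riccati_rhs_def matrix_mult_add_left matrix_mult_add_right
            bounded_bilinear.minus_right[OF bounded_bilinear_matrix_matrix_mult] matrix_mult_diff_right matrix_mul_assoc UW W(2)[OF t])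
  qed
  moreover have "V 0 ** W 0 = Y1"
    using W(1)[of 0] h by (simp add: U_def V_def X0 id_zero_row_id_over zero_id_row_id_over)
  ultimately show ?thesis
    by (auto simp: riccati_exists_at_def riccati_solution_on_def)
qed

section \<open>Restriction, gluing and uniqueness of solutions\<close>

lemma riccati_solution_on_subset:
  assumes "riccati_solution_on A Y0 T Y" "S \<subseteq> T"
  shows "riccati_solution_on A Y0 S Y"
  using assms unfolding riccati_solution_on_def by (blast intro: has_vector_derivative_within_subset)

lemma riccati_solution_on_continuous_on:
  "riccati_solution_on A Y0 T Y \<Longrightarrow> continuous_on T Y"
  unfolding riccati_solution_on_def
  by (intro continuous_on_vector_derivative[where f' = "\<lambda>t. riccati_rhs A (Y t)"]) blast

lemma riccati_exists_at_mono:
  "riccati_exists_at A Y0 t \<Longrightarrow> s \<le> t \<Longrightarrow> riccati_exists_at A Y0 s"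
  unfolding riccati_exists_at_def using riccati_solution_on_subset[of A Y0 "{0..t}" _ "{0..s}"] by auto

lemma riccati_exists_at_0: "riccati_exists_at A Y0 0"
  by (auto simp: riccati_exists_at_def riccati_solution_on_def has_vector_derivative_def
      has_derivative_within_singleton_iff intro!: exI[of _ "\<lambda>_. Y0"] bounded_linear_scaleR_left)

text \<open>The equation is autonomous, so a solution started at \<open>Y s\<close> may be shifted
  by \<open>s\<close>. At the joint both pieces have the same value, hence the same one-sided
  derivative.\<close>

lemma riccati_exists_at_concat:
  assumes Y: "riccati_solution_on A Y0 {0..s} Y" and h: "riccati_exists_at A (Y s) h"
    and s: "0 \<le> s" and h0: "0 \<le> h"
  shows "riccati_exists_at A Y0 (s + h)"
proof -
  obtain Z where Z0: "Z 0 = Y s"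
    and Z: "\<And>t. t \<in> {0..h} \<Longrightarrow> (Z has_vector_derivative riccati_rhs A (Z t)) (at t within {0..h})"
    using h by (auto simp: riccati_exists_at_def riccati_solution_on_def)
  define Q where "Q t = (if t \<in> {0..s} then Y t else Z (t - s))" for t
  \<comment> \<open>The closed intervals meet only in \<open>s\<close>, which belongs to both, so
    the sets enlarged by the gluing rule are the intervals themselves.\<close>
  have un: "{0..s} \<union> (closure {0..s} \<inter> closure {s..s + h}) = {0..s}"
      "{s..s + h} \<union> (closure {0..s} \<inter> closure {s..s + h}) = {s..s + h}"
    using s h0 by auto
  have shift: "((\<lambda>t. Z (t - s)) has_vector_derivative riccati_rhs A (Z (t - s))) (at t within {s..s + h})"
    if "t \<in> {s..s + h}" for t
  proof -
    have "(\<lambda>t. t - s) ` {s..s + h} = {0..h}"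
      by (simp add: image_diff_atLeastAtMost)
    then have "(Z has_vector_derivative riccati_rhs A (Z (t - s))) (at (t - s) within (\<lambda>t. t - s) ` {s..s + h})"
      using Z[of "t - s"] that by simp
    moreover have "((\<lambda>t. t - s) has_vector_derivative 1) (at t within {s..s + h})"
      by (auto intro!: derivative_eq_intros)
    ultimately show ?thesis
      using vector_diff_chain_within[of "\<lambda>t. t - s" 1 t "{s..s + h}" Z] by (simp add: o_def)
  qed
  have "(Q has_vector_derivative riccati_rhs A (Q t)) (at t within {0..s + h})" if t: "t \<in> {0..s + h}" for t
  proof -
    have "((\<lambda>t. if t \<in> {0..s} then Y t else Z (t - s)) has_vector_derivative
        (if t \<in> {0..s} then riccati_rhs A (Y t) else riccati_rhs A (Z (t - s)))) (at t within {0..s + h})"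
    proof (rule has_vector_derivative_If_within_closures[where S = "{0..s}" and T = "{s..s + h}"])
      show "t \<in> {0..s} \<union> {s..s + h}" "{0..s + h} = {0..s} \<union> {s..s + h}"
        using t s h0 by auto
      show "(Y has_vector_derivative riccati_rhs A (Y t))
          (at t within {0..s} \<union> (closure {0..s} \<inter> closure {s..s + h}))"
        if "t \<in> {0..s} \<union> (closure {0..s} \<inter> closure {s..s + h})"
        using that Y unfolding un riccati_solution_on_def by blast
      show "((\<lambda>t. Z (t - s)) has_vector_derivative riccati_rhs A (Z (t - s)))
          (at t within {s..s + h} \<union> (closure {0..s} \<inter> closure {s..s + h}))"
        if "t \<in> {s..s + h} \<union> (closure {0..s} \<inter> closure {s..s + h})"
        using that unfolding un by (rule shift)
    qed (auto simp: Z0)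
    then show ?thesis unfolding Q_def by (simp add: if_distrib)
  qed
  moreover have "Q 0 = Y0" using Y s by (simp add: Q_def riccati_solution_on_def)
  ultimately show ?thesis
    unfolding riccati_exists_at_def riccati_solution_on_def by blast
qed

text \<open>The splitting \<open>Y A12 Y - Z A12 Z = D A12 Y + Z A12 D\<close> with
  \<open>D = Y - Z\<close> makes \<open>D\<close> solve a linear equation. Its coefficients are
  bounded on the compact interval, and Gronwall's inequality applies with
  \<open>D 0 = 0\<close>.\<close>

lemma riccati_solution_unique:
  fixes A :: "real^('k::finite + 'm::finite)^('k + 'm)"
  assumes Y: "riccati_solution_on A Y0 {0..T} Y" and Z: "riccati_solution_on A Y0 {0..T} Z"
    and t: "t \<in> {0..T}"
  shows "Y t = Z t"
proof -
  define D where "D s = Y s - Z s" for s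
  define E where "E s = block22 A ** D s - D s ** block11 A - D s ** (block12 A ** Y s)
    - (Z s ** block12 A) ** D s" for s
  have D': "(D has_vector_derivative E s) (at s within {0..T})" if "s \<in> {0..T}" for s
    unfolding D_def
    by (rule has_vector_derivative_eq_rhs[OF has_vector_derivative_diff])
      (use that Y Z in \<open>auto simp: riccati_solution_on_def riccati_rhs_def D_def E_def
        matrix_mult_diff_left matrix_mult_diff_right matrix_mul_assoc\<close>)
  have "bounded ((\<lambda>s. block12 A ** Y s) ` {0..T})" "bounded ((\<lambda>s. Z s ** block12 A) ` {0..T})"
    by (auto intro!: compact_imp_bounded compact_continuous_image
        bounded_bilinear.continuous_on[OF bounded_bilinear_matrix_matrix_mult]
        riccati_solution_on_continuous_on[OF Y] riccati_solution_on_continuous_on[OF Z] continuous_on_const)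
  then obtain M1 M2 where M1: "\<And>s. s \<in> {0..T} \<Longrightarrow> norm (block12 A ** Y s) \<le> M1"
    and M2: "\<And>s. s \<in> {0..T} \<Longrightarrow> norm (Z s ** block12 A) \<le> M2"
    unfolding bounded_iff ball_simps by blast
  \<comment> \<open>The bilinear bound on matrix products comes with a constant that depends on the
    matrix shapes; two shapes occur.\<close>
  obtain K1 where K1: "0 < K1" "\<And>(P :: real^'m^'m) (Q :: real^'k^'m). norm (P ** Q) \<le> norm P * norm Q * K1"
    using bounded_bilinear.pos_bounded[OF bounded_bilinear_matrix_matrix_mult] by blast
  obtain K2 where K2: "0 < K2" "\<And>(P :: real^'k^'m) (Q :: real^'k^'k). norm (P ** Q) \<le> norm P * norm Q * K2"
    using bounded_bilinear.pos_bounded[OF bounded_bilinear_matrix_matrix_mult] by blast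
  define L where "L = norm (block22 A) * K1 + norm (block11 A) * K2 + M1 * K2 + M2 * K1"
  have bound: "E s \<bullet> D s \<le> L * (D s \<bullet> D s)" if s: "s \<in> {0..T}" for s
  proof -
    have "norm (E s) \<le> norm (block22 A ** D s) + norm (D s ** block11 A)
        + norm (D s ** (block12 A ** Y s)) + norm ((Z s ** block12 A) ** D s)"
      unfolding E_def by (intro order_trans[OF norm_triangle_ineq4] add_mono order_refl)
    also have "\<dots> \<le> norm (block22 A) * norm (D s) * K1 + norm (D s) * norm (block11 A) * K2
        + norm (D s) * M1 * K2 + M2 * norm (D s) * K1"
      by (intro add_mono K1(2) K2(2) order_trans[OF K1(2)] order_trans[OF K2(2)] mult_right_mono
          mult_left_mono M1[OF s] M2[OF s] less_imp_le[OF K1(1)] less_imp_le[OF K2(1)] norm_ge_zero)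
    also have "\<dots> = L * norm (D s)" by (simp add: L_def algebra_simps)
    finally have "norm (E s) * norm (D s) \<le> L * norm (D s) * norm (D s)"
      by (rule mult_right_mono) simp
    then have "E s \<bullet> D s \<le> L * norm (D s) * norm (D s)"
      using norm_cauchy_schwarz[of "E s" "D s"] by linarith
    then show ?thesis
      by (simp add: power2_norm_eq_inner[symmetric] power2_eq_square)
  qed
  have "norm (D t) \<le> exp (L * t) * norm (D 0)"
    by (rule gronwall_inner[OF D' bound t])
  moreover have "D 0 = 0" using Y Z by (simp add: D_def riccati_solution_on_def)
  ultimately show ?thesis by (simp add: D_def)
qed

text \<open>Uniqueness on \<open>{0..t}\<close> gives the definite description its value, which any
  solution on a longer interval attains.\<close>

lemma riccati_flow_eq:
  assumes Y: "riccati_solution_on A Y0 {0..T} Y" and t: "t \<in> {0..T}"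
  shows "riccati_flow A Y0 t = Y t"
proof -
  have sub: "riccati_solution_on A Y0 {0..t} Y"
    using t by (intro riccati_solution_on_subset[OF Y]) auto
  then show ?thesis
    unfolding riccati_flow_def using t
    by (intro the_equality) (auto intro: riccati_solution_unique[where T = t])
qed

lemma riccati_exists_at_add:
  fixes A :: "real^('k::finite + 'm::finite)^('k + 'm)"
  assumes s: "riccati_exists_at A Y0 s" "0 \<le> s" and h: "0 \<le> h" and a: "0 < a" "onorm ((*v) A) \<le> a"
    and small: "onorm ((*v) (id_zero_row ** A :: real^('k + 'm)^'k)) * onorm ((*v) (id_over (riccati_flow A Y0 s)))
      * (exp (a * h) - 1) < a"
  shows "riccati_exists_at A Y0 (s + h)"
proof -
  obtain Y where Y: "riccati_solution_on A Y0 {0..s} Y"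
    using s by (auto simp: riccati_exists_at_def)
  then have "riccati_flow A Y0 s = Y s" using s by (intro riccati_flow_eq) auto
  then have "riccati_exists_at A (Y s) h"
    using small h a by (intro riccati_exists_at_short) auto
  then show ?thesis using Y s h by (intro riccati_exists_at_concat)
qed

section \<open>The Lambert function and the step length\<close>

text \<open>The map \<open>x * exp x\<close> is strictly increasing on the nonnegative reals. The
  intermediate value theorem on \<open>{0..x}\<close> finds a preimage, because
  \<open>x \<le> x * exp x\<close>.\<close>

lemma lambert_W:
  assumes "0 \<le> x"
  shows "0 \<le> lambert_W x" "lambert_W x * exp (lambert_W x) = x"
proof -
  let ?f = "\<lambda>x :: real. x * exp x"
  have mono: "strict_mono_on {0..} ?f"
    by (auto intro!: strict_mono_onI mult_strict_mono)
  then have inj: "inj_on ?f {0..}" by (rule strict_mono_on_imp_inj_on)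
  have "\<exists>w\<ge>0. w \<le> x \<and> ?f w = x"
    using assms mult_left_mono[of 1 "exp x" x]
    by (intro IVT') (auto intro!: continuous_intros)
  then have x: "x \<in> ?f ` {0..}" by auto
  show "lambert_W x * exp (lambert_W x) = x"
    unfolding lambert_W_def by (rule f_the_inv_into_f[OF inj x])
  show "0 \<le> lambert_W x"
    using the_inv_into_into[OF inj x subset_refl] by (simp add: lambert_W_def)
qed

text \<open>The operator norm dominates every entry, and the identity block has an entry
  \<open>1\<close>. This keeps the denominator in the step length away from zero.\<close>

lemma onorm_id_over_ge_1:
  fixes Y :: "real^'k::finite^'m::finite"
  shows "1 \<le> onorm ((*v) (id_over Y))"
proof -
  fix j :: 'k
  have "\<bar>id_over Y $ Inl j $ j\<bar> \<le> onorm ((*v) (id_over Y))"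
    by (rule matrix_component_le_onorm)
  then show ?thesis by (simp add: id_over_def mat_def)
qed

text \<open>The equation is \<open>w * exp w = a / (b * N)\<close> with \<open>w = a * h\<close>.
  The rest of the proof knows the step only through these two facts.\<close>

lemma riccati_step_eq:
  fixes A :: "real^('k::finite + 'm::finite)^('k + 'm)" and Y0 :: "real^'k^'m" and s :: real
  defines "a \<equiv> onorm ((*v) A)" and "b \<equiv> onorm ((*v) (id_zero_row ** A :: real^('k + 'm)^'k))"
    and "N \<equiv> onorm ((*v) (id_over (riccati_flow A Y0 s)))"
    and "h \<equiv> riccati_step A Y0 s"
  assumes a: "0 < a" and b: "0 < b"
  shows "0 < h" "b * N * h * exp (a * h) = 1"
proof -
  have N: "0 < N" using onorm_id_over_ge_1[of "riccati_flow A Y0 s"] by (simp add: N_def)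
  define w where "w = lambert_W (a / (b * N))"
  have w: "0 \<le> w" "w * exp w = a / (b * N)"
    using lambert_W[of "a / (b * N)"] a b N by (auto simp: w_def)
  have h: "h = w / a"
    by (simp add: h_def w_def riccati_step_def max_singular_value_eq_onorm a_def b_def N_def)
  have "w \<noteq> 0" using w(2) a b N by auto
  then show "0 < h" using w(1) a by (simp add: h)
  show "b * N * h * exp (a * h) = 1" using w(2) a b N by (simp add: h field_simps)
qed

lemma exp_minus_one_less:
  fixes x :: real
  assumes "0 < x"
  shows "exp x - 1 < x * exp x"
proof -
  obtain z where "0 < z" "z < x" "exp x - exp 0 = (x - 0) * exp z"
    using MVT2[of 0 x exp exp] assms by (auto intro: DERIV_exp)
  then show ?thesis using assms by simp
qed

section \<open>Steps and the escape time\<close>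

text \<open>Existence is inherited by earlier times. From this alone, existence at \<open>s\<close>
  gives only \<open>s \<le> escape_time A Y0\<close>; the margin \<open>e\<close> makes the
  inequality strict.\<close>

lemma less_escape_time_iff:
  assumes "0 \<le> s"
  shows "ereal s < escape_time A Y0 \<longleftrightarrow> (\<exists>e>0. riccati_exists_at A Y0 (s + e))"
proof
  assume s: "ereal s < escape_time A Y0"
  then obtain r where r: "s < r" "ereal r < escape_time A Y0"
    using ereal_dense2[OF s] by auto
  have "riccati_exists_at A Y0 r"
  proof (rule ccontr)
    assume "\<not> riccati_exists_at A Y0 r"
    then have "escape_time A Y0 \<le> ereal r"
      unfolding escape_time_def using r assms by (intro Inf_lower) auto
    then show False using r by simp
  qed
  then show "\<exists>e>0. riccati_exists_at A Y0 (s + e)"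
    using r by (intro exI[of _ "r - s"]) auto
next
  assume "\<exists>e>0. riccati_exists_at A Y0 (s + e)"
  then obtain e where e: "0 < e" "riccati_exists_at A Y0 (s + e)" by blast
  have "ereal (s + e) \<le> escape_time A Y0"
    unfolding escape_time_def
  proof (rule Inf_greatest)
    fix y assume "y \<in> {ereal t |t. 0 < t \<and> \<not> riccati_exists_at A Y0 t}"
    then obtain t where "y = ereal t" "\<not> riccati_exists_at A Y0 t" by blast
    then show "ereal (s + e) \<le> y"
      using riccati_exists_at_mono[OF e(2), of t] by force
  qed
  then show "ereal s < escape_time A Y0"
    using e(1) by (intro less_le_trans[OF _ \<open>ereal (s + e) \<le> escape_time A Y0\<close>]) simp
qed

lemma less_escape_time_imp_riccati_exists_at:
  assumes "0 \<le> s" "ereal s < escape_time A Y0"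
  shows "riccati_exists_at A Y0 s"
  using assms riccati_exists_at_mono[of A Y0 _ s] by (auto simp: less_escape_time_iff)

text \<open>If the upper block row of \<open>A\<close> vanishes, the smallness condition for
  existence holds at every time, so no solution escapes. If \<open>A\<close> vanishes, so does that
  row.\<close>

lemma escape_time_finite_imp_onorm_pos:
  fixes A :: "real^('k::finite + 'm::finite)^('k + 'm)" and Y0 :: "real^'k^'m"
  assumes "escape_time A Y0 < \<infinity>"
  shows "0 < onorm ((*v) (id_zero_row ** A :: real^('k + 'm)^'k))" "0 < onorm ((*v) A)"
proof -
  let ?b = "onorm ((*v) (id_zero_row ** A :: real^('k + 'm)^'k))"
  show b: "0 < ?b"
  proof (rule ccontr)
    assume "\<not> 0 < ?b"
    then have b0: "?b = 0" using onorm_pos_le[of "(*v) (id_zero_row ** A :: real^('k + 'm)^'k)"] by simp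
    have ex: "riccati_exists_at A Y0 t" if "0 \<le> t" for t
      using that b0 onorm_pos_le[of "(*v) A"]
      \<comment> \<open>Adding \<open>1\<close> keeps the growth rate positive even when
        \<open>A\<close> is zero.\<close>
      by (intro riccati_exists_at_short[where a = "onorm ((*v) A) + 1"]) auto
    then have "{ereal t |t. 0 < t \<and> \<not> riccati_exists_at A Y0 t} = {}" by force
    then have "escape_time A Y0 = \<infinity>"
      unfolding escape_time_def by (simp only: Inf_empty top_ereal_def)
    then show False using assms by simp
  qed
  show "0 < onorm ((*v) A)"
  proof (rule ccontr)
    assume "\<not> 0 < onorm ((*v) A)"
    then have "onorm ((*v) A) = 0" using onorm_pos_le[of "(*v) A"] by simp
    then have "A *v x = 0" for x
      using onorm_eq_0[of "(*v) A"] by simp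
    then have "onorm ((*v) (id_zero_row ** A :: real^('k + 'm)^'k)) = 0"
      by (subst onorm_eq_0) (auto simp: matrix_vector_mul_assoc[symmetric])
    then show False using b by simp
  qed
qed

text \<open>The step equation and the strict inequality \<open>exp x - 1 < x * exp x\<close> give
  the smallness condition at \<open>h\<close> with room to spare. By continuity it persists at some
  \<open>h + e\<close> with \<open>e > 0\<close>, so the solution exists beyond
  \<open>s + h\<close>.\<close>

lemma riccati_step_below_escape_time:
  fixes A :: "real^('k::finite + 'm::finite)^('k + 'm)" and Y0 :: "real^'k^'m"
  assumes fin: "escape_time A Y0 < \<infinity>" and s: "0 \<le> s" "riccati_exists_at A Y0 s"
  shows "ereal (s + riccati_step A Y0 s) < escape_time A Y0"
proof -
  define a where "a = onorm ((*v) A)"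
  define b where "b = onorm ((*v) (id_zero_row ** A :: real^('k + 'm)^'k))"
  define N where "N = onorm ((*v) (id_over (riccati_flow A Y0 s)))"
  define h where "h = riccati_step A Y0 s"
  have a: "0 < a" and b: "0 < b"
    using escape_time_finite_imp_onorm_pos[OF fin] by (simp_all add: a_def b_def)
  have h: "0 < h" "b * N * h * exp (a * h) = 1"
    using riccati_step_eq[of A Y0 s] a b by (simp_all add: a_def b_def N_def h_def)
  have N: "0 < N" using onorm_id_over_ge_1[of "riccati_flow A Y0 s"] by (simp add: N_def)
  have "b * N * (exp (a * h) - 1) < b * N * (a * h * exp (a * h))"
    using exp_minus_one_less[of "a * h"] a b N h(1) by (intro mult_strict_left_mono) auto
  also have "\<dots> = a" using h(2) by (simp add: mult_ac)
  finally have lt: "b * N * (exp (a * h) - 1) < a" .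
  have "((\<lambda>e. b * N * (exp (a * (h + e)) - 1)) \<longlongrightarrow> b * N * (exp (a * (h + 0)) - 1)) (at_right 0)"
    by (intro tendsto_intros)
  then have "\<forall>\<^sub>F e in at_right 0. b * N * (exp (a * (h + e)) - 1) < a"
    using lt by (intro order_tendstoD) auto
  then have "\<forall>\<^sub>F e in at_right 0. b * N * (exp (a * (h + e)) - 1) < a \<and> 0 < e"
    using eventually_at_right_less[of 0] by eventually_elim auto
  then obtain e where e: "0 < e" "b * N * (exp (a * (h + e)) - 1) < a"
    using eventually_happens[of _ "at_right (0::real)"] by auto
  have "riccati_exists_at A Y0 (s + (h + e))"
    using s h(1) e a by (intro riccati_exists_at_add[where a = a]) (auto simp: a_def b_def N_def)
  then show ?thesis
    using e(1) s(1) h(1) unfolding h_def[symmetric]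
    by (subst less_escape_time_iff) (auto simp: add.assoc)
qed

text \<open>A solution is continuous on the compact interval, hence bounded in the Euclidean norm of
  matrices; the constant \<open>C\<close> passes to the operator norm.\<close>

lemma riccati_flow_bounded:
  fixes A :: "real^('k::finite + 'm::finite)^('k + 'm)" and Y0 :: "real^'k^'m"
  assumes "riccati_exists_at A Y0 T"
  obtains K where "\<And>s. s \<in> {0..T} \<Longrightarrow> onorm ((*v) (id_over (riccati_flow A Y0 s))) \<le> K"
proof -
  obtain Y where Y: "riccati_solution_on A Y0 {0..T} Y"
    using assms by (auto simp: riccati_exists_at_def)
  have "continuous_on {0..T} (\<lambda>s. id_over (Y s) :: real^'k^('k + 'm))"
    unfolding id_over_def
  proof (intro continuous_on_vec_lambda)
    fix i :: "'k + 'm" and j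
    show "continuous_on {0..T} (\<lambda>s. case i of Inl l \<Rightarrow> mat 1 $ l $ j | Inr l \<Rightarrow> Y s $ l $ j)"
      using riccati_solution_on_continuous_on[OF Y] by (cases i) (auto intro!: continuous_intros)
  qed
  then have "bounded ((\<lambda>s. id_over (Y s) :: real^'k^('k + 'm)) ` {0..T})"
    by (intro compact_imp_bounded compact_continuous_image) auto
  then obtain M where M: "\<And>s. s \<in> {0..T} \<Longrightarrow> norm (id_over (Y s) :: real^'k^('k + 'm)) \<le> M"
    unfolding bounded_iff ball_simps by blast
  obtain C where C: "0 < C"
      "\<And>(P :: real^'k^('k + 'm)) x. norm (P *v x) \<le> norm P * norm x * C"
    using bounded_bilinear.pos_bounded[OF bounded_bilinear_matrix_vector_mult] by blast
  have "onorm ((*v) (id_over (riccati_flow A Y0 s))) \<le> M * C" if "s \<in> {0..T}" for s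
  proof (rule onorm_le)
    fix x
    have "norm (id_over (Y s) *v x) \<le> norm (id_over (Y s) :: real^'k^('k + 'm)) * norm x * C" by (rule C)
    also have "\<dots> \<le> M * norm x * C"
      using C(1) M[OF that] by (intro mult_right_mono) auto
    finally show "norm (id_over (riccati_flow A Y0 s) *v x) \<le> M * C * norm x"
      using riccati_flow_eq[OF Y that] by (simp add: mult_ac)
  qed
  then show thesis by (rule that)
qed

section \<open>Convergence of the time sequence\<close>

theorem theorem4p1:
  fixes A :: "real^('k::finite + 'm::finite)^('k + 'm)"
    and Y0 :: "real^'k^'m"
    and t :: "nat \<Rightarrow> real"
  assumes "escape_time A Y0 < \<infinity>"
    and "t 0 = 0"
    and "\<And>n. t (Suc n) = t n + riccati_step A Y0 (t n)"
  shows "(\<forall>s. 0 \<le> s \<and> ereal s < escape_time A Y0 \<longrightarrow> 0 < riccati_step A Y0 s)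
       \<and> (\<forall>n. 0 \<le> t n \<and> ereal (t n) < escape_time A Y0)
       \<and> (\<lambda>n. ereal (t n)) \<longlonglongrightarrow> escape_time A Y0"
proof -
  define a where "a = onorm ((*v) A)"
  define b where "b = onorm ((*v) (id_zero_row ** A :: real^('k + 'm)^'k))"
  define N where "N s = onorm ((*v) (id_over (riccati_flow A Y0 s)))" for s
  have a: "0 < a" and b: "0 < b"
    using escape_time_finite_imp_onorm_pos[OF assms(1)] by (simp_all add: a_def b_def)
  \<comment> \<open>Both facts hold for every real \<open>s\<close>, because the norm
    \<open>N s\<close> is at least \<open>1\<close> whatever value \<open>riccati_flow\<close>
    takes.\<close>
  have step_pos: "0 < riccati_step A Y0 s"
    and step_eq: "b * N s * riccati_step A Y0 s * exp (a * riccati_step A Y0 s) = 1" for s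
    using riccati_step_eq[of A Y0 s] a b by (simp_all add: a_def b_def N_def)
  \<comment> \<open>The first step shows that the escape time is positive, which is the base case of
    the induction.\<close>
  have "ereal (0 + riccati_step A Y0 0) < escape_time A Y0"
    using riccati_step_below_escape_time[OF assms(1) _ riccati_exists_at_0] by simp
  then have "ereal 0 < escape_time A Y0"
    using step_pos[of 0] by (elim less_trans[rotated]) simp
  then have t: "0 \<le> t n \<and> ereal (t n) < escape_time A Y0" for n
  proof (induction n)
    case (Suc n)
    then show ?case
      using riccati_step_below_escape_time[OF assms(1) _ less_escape_time_imp_riccati_exists_at, of "t n"]
        step_pos[of "t n"] by (simp add: assms(3))
  qed (simp add: assms(2))
  obtain T where T: "escape_time A Y0 = ereal T"
    using assms(1) \<open>ereal 0 < escape_time A Y0\<close> by (cases "escape_time A Y0") auto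
  have "incseq t"
    using step_pos by (intro incseq_SucI) (simp add: assms(3) less_imp_le)
  moreover have "t n \<le> T" for n using t[of n] by (simp add: T)
  ultimately obtain L where L: "t \<longlonglongrightarrow> L" "\<And>n. t n \<le> L"
    using incseq_convergent[of t T] by blast
  have "L \<le> T" by (rule LIMSEQ_le_const2[OF L(1)]) (simp add: \<open>\<And>n. t n \<le> T\<close>)
  moreover have "\<not> L < T"
  proof
    assume "L < T"
    moreover have "0 \<le> L" using L(2)[of 0] assms(2) by simp
    ultimately have "riccati_exists_at A Y0 L"
      by (intro less_escape_time_imp_riccati_exists_at) (auto simp: T)
    then obtain K where K: "\<And>s. s \<in> {0..L} \<Longrightarrow> N s \<le> K"
      unfolding N_def by (rule riccati_flow_bounded) blast
    have "(\<lambda>n. t (Suc n) - t n) \<longlonglongrightarrow> L - L"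
      by (intro tendsto_diff L(1) LIMSEQ_Suc)
    then have h: "(\<lambda>n. riccati_step A Y0 (t n)) \<longlonglongrightarrow> 0" by (simp add: assms(3))
    have "(\<lambda>n. b * K * riccati_step A Y0 (t n) * exp (a * riccati_step A Y0 (t n)))
        \<longlonglongrightarrow> b * K * 0 * exp (a * 0)"
      by (intro tendsto_intros h)
    \<comment> \<open>All \<open>t n\<close> lie in \<open>{0..L}\<close>, so \<open>N (t n)\<close>
      may be replaced by \<open>K\<close> in the step equation. The right-hand side tends to
      \<open>0\<close>, a contradiction.\<close>
    moreover have "1 \<le> b * K * riccati_step A Y0 (t n) * exp (a * riccati_step A Y0 (t n))" for n
      unfolding step_eq[of "t n", symmetric] using K[of "t n"] t[of n] L(2)[of n] b step_pos[of "t n"]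
      by (intro mult_right_mono mult_left_mono) auto
    ultimately show False
      using LIMSEQ_le_const[of _ 0 "1::real"] by fastforce
  qed
  ultimately have "L = T" by simp
  then show ?thesis using L(1) t step_pos by (simp add: T)
qed

end
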